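(* Every finite simple connected triangle-free graph is $P_3$-connected.
   Context: All graphs are finite and simple. An induced $P_3$ in a graph $G$ is a triple of distinct vertices $a,b,c$ with $ab,bc\in E(G)$ and $ac\notin E(G)$; its two edges are $ab$ and $bc$. For edges $e,f$ of $G$, $e$ and $f$ are $P_3$-connected in $G$ if there is a sequence of edges $e=e_0,e_1,\ldots,e_k=f$ of $G$ (with $k\ge 0$) such that for every $0\le i\le k-1$, $e_i$ and $e_{i+1}$ are the two edges of an induced $P_3$ in $G$. The graph $G$ is $P_3$-connected if every pair of edges of $G$ are $P_3$-connected in $G$. *)

theory Defs
  imports "Graph_Theory.Digraph_Component"
begin

text \<open>
  Finite simple graphs are taken in the sense of the locale \<^locale>\<open>graph\<close>: finite, loop-free
  symmetric digraphs without parallel arcs. An undirected edge is thus represented by a pair of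
  opposite arcs; it is identified here with the two-element set of its ends.
\<close>

definition uedges :: "('a, 'b) pre_digraph \<Rightarrow> 'a set set" where
  "uedges G = {{u, v} | u v. u \<rightarrow>\<^bsub>G\<^esub> v}"

definition triangle_free :: "('a, 'b) pre_digraph \<Rightarrow> bool" where
  "triangle_free G \<longleftrightarrow>
     \<not> (\<exists>a b c. distinct [a, b, c] \<and> {a, b} \<in> uedges G \<and> {b, c} \<in> uedges G \<and> {a, c} \<in> uedges G)"

definition induced_P3 :: "('a, 'b) pre_digraph \<Rightarrow> 'a \<Rightarrow> 'a \<Rightarrow> 'a \<Rightarrow> bool" where
  "induced_P3 G a b c \<longleftrightarrow>
     distinct [a, b, c] \<and> {a, b} \<in> uedges G \<and> {b, c} \<in> uedges G \<and> {a, c} \<notin> uedges G"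

text \<open>This relation is symmetric, as an induced \<open>P\<^sub>3\<close> can be read from either end.\<close>

definition edges_of_induced_P3 :: "('a, 'b) pre_digraph \<Rightarrow> 'a set \<Rightarrow> 'a set \<Rightarrow> bool" where
  "edges_of_induced_P3 G e f \<longleftrightarrow> (\<exists>a b c. induced_P3 G a b c \<and> e = {a, b} \<and> f = {b, c})"

definition P3_connected_edges :: "('a, 'b) pre_digraph \<Rightarrow> 'a set \<Rightarrow> 'a set \<Rightarrow> bool" where
  "P3_connected_edges G e f \<longleftrightarrow>
     (\<exists>(k::nat) s. s 0 = e \<and> s k = f \<and> (\<forall>i\<le>k. s i \<in> uedges G) \<and>
        (\<forall>i<k. edges_of_induced_P3 G (s i) (s (Suc i))))"

definition P3_connected :: "('a, 'b) pre_digraph \<Rightarrow> bool" where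
  "P3_connected G \<longleftrightarrow> (\<forall>e \<in> uedges G. \<forall>f \<in> uedges G. P3_connected_edges G e f)"

end

theory Submission
  imports Defs
begin

text \<open>
  In a triangle-free graph any two distinct edges that share an end form an induced \<open>P\<^sub>3\<close>, since
  the third edge would close a triangle (\<open>P3_connected_edges_shared_end\<close>). The edges along a walk
  consecutively share ends, so every edge is \<open>P\<^sub>3\<close>-connected to all edges at any vertex
  that can be reached from one of its own ends; connectedness makes that every vertex.
\<close>

lemma P3_connected_edges_refl:
  assumes "e \<in> uedges G"
  shows "P3_connected_edges G e e"
  unfolding P3_connected_edges_def
  by (rule exI[of _ 0], rule exI[of _ "\<lambda>_. e"]) (simp add: assms)

lemma P3_connected_edges_step:
  assumes "P3_connected_edges G e f" and "edges_of_induced_P3 G f g"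
  shows "P3_connected_edges G e g"
proof -
  obtain k s where s: "s (0::nat) = e" "s k = f" "\<forall>i\<le>k. s i \<in> uedges G"
      "\<forall>i<k. edges_of_induced_P3 G (s i) (s (Suc i))"
    using assms(1) unfolding P3_connected_edges_def by blast
  have "g \<in> uedges G"
    using assms(2) unfolding edges_of_induced_P3_def induced_P3_def by blast
  let ?t = "s(Suc k := g)"
  have "?t 0 = e" "?t (Suc k) = g" "\<forall>i\<le>Suc k. ?t i \<in> uedges G"
    using s \<open>g \<in> uedges G\<close> by (auto simp: le_Suc_eq)
  moreover have "\<forall>i<Suc k. edges_of_induced_P3 G (?t i) (?t (Suc i))"
    using s assms(2) by (auto simp: less_Suc_eq)
  ultimately show ?thesis
    unfolding P3_connected_edges_def by blast
qed

lemma (in loopfree_digraph) uedges_distinct_ends: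
  assumes "{u, v} \<in> uedges G"
  shows "u \<noteq> v"
  using assms adj_not_same by (fastforce simp: uedges_def doubleton_eq_iff)

text \<open>
  This is where triangle-freeness enters: the two edges at \<open>w\<close> either coincide or have
  non-adjacent far ends, so that they are the edges of an induced \<open>P\<^sub>3\<close> with middle vertex \<open>w\<close>.
\<close>

lemma (in loopfree_digraph) P3_connected_edges_shared_end:
  assumes "triangle_free G" and "P3_connected_edges G e {x, w}"
    and "{x, w} \<in> uedges G" and "{w, y} \<in> uedges G"
  shows "P3_connected_edges G e {w, y}"
proof (cases "x = y")
  case True
  then show ?thesis using assms(2) by (simp add: insert_commute)
next
  case False
  have "x \<noteq> w" "w \<noteq> y"
    using assms(3,4) uedges_distinct_ends by blast+
  then have "induced_P3 G x w y"
    using False assms(1,3,4) unfolding induced_P3_def triangle_free_def by auto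
  then have "edges_of_induced_P3 G {x, w} {w, y}"
    unfolding edges_of_induced_P3_def by blast
  with assms(2) show ?thesis by (rule P3_connected_edges_step)
qed

text \<open>
  Quantifying over all edges at the vertex reached makes the induction along the walk work: the
  arc of the walk that leads to \<open>w\<close> is itself an edge at the preceding vertex, hence covered by
  the induction hypothesis, and it shares the end \<open>w\<close> with every edge at \<open>w\<close>.
\<close>

lemma (in loopfree_digraph) P3_connected_edges_reachable:
  assumes "triangle_free G" and "{u, v} \<in> uedges G"
    and "u \<rightarrow>\<^sup>*\<^bsub>G\<^esub> w" and "{w, y} \<in> uedges G"
  shows "P3_connected_edges G {u, v} {w, y}"
  using assms(3,4)
proof (induction arbitrary: y rule: reachable_induct)
  case base
  have "P3_connected_edges G {u, v} {v, u}"
    using P3_connected_edges_refl[OF assms(2)] by (simp add: insert_commute)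
  moreover have "{v, u} \<in> uedges G"
    using assms(2) by (simp add: insert_commute)
  ultimately show ?case
    using base.prems by (rule P3_connected_edges_shared_end[OF assms(1)])
next
  case (step x w)
  have xw: "{x, w} \<in> uedges G"
    using step.hyps(2) unfolding uedges_def by blast
  then have "P3_connected_edges G {u, v} {x, w}"
    by (rule step.IH)
  then show ?case
    using xw step.prems by (rule P3_connected_edges_shared_end[OF assms(1)])
qed

theorem corollary1p2:
  fixes G :: "('a, 'b) pre_digraph"
  assumes "graph G"
    and "connected G"
    and "triangle_free G"
  shows "P3_connected G"
proof -
  interpret graph G by fact
  have "P3_connected_edges G e f" if "e \<in> uedges G" "f \<in> uedges G" for e f
  proof -
    obtain u v where uv: "e = {u, v}" "u \<rightarrow>\<^bsub>G\<^esub> v"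
      using \<open>e \<in> uedges G\<close> unfolding uedges_def by blast
    obtain w y where wy: "f = {w, y}" "w \<rightarrow>\<^bsub>G\<^esub> y"
      using \<open>f \<in> uedges G\<close> unfolding uedges_def by blast
    have "strongly_connected G"
      using sym_arcs assms(2) by (rule symmetric_connected_imp_strongly_connected)
    then have "u \<rightarrow>\<^sup>*\<^bsub>G\<^esub> w"
      using adj_in_verts(1)[OF uv(2)] adj_in_verts(1)[OF wy(2)]
      unfolding strongly_connected_def by blast
    then show ?thesis
      using P3_connected_edges_reachable[OF assms(3)] that unfolding uv(1) wy(1) by blast
  qed
  then show ?thesis
    unfolding P3_connected_def by blast
qed

end
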